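(* Let $A \in \mathbb{Z}^{d \times n}$ be a unimodular matrix, let $A^{\pm} \in \mathbb{Z}^{(d+1)\times(2n+1)}$ be its centrally symmetric configuration, let $K$ be a field and let $I_{A^\pm} \subset K[\mathbf{x}] = K[x_1,\ldots,x_{2n+1}]$ be the toric ideal of $A^\pm$. Then there exists a reverse lexicographic order $<$ on $K[\mathbf{x}]$ such that the initial ideal $\mathrm{in}_<(I_{A^\pm})$ of $I_{A^\pm}$ with respect to $<$ is a radical ideal.
   Context: An integer matrix $A \in \mathbb{Z}^{d\times n}$ of rank $d$ is called unimodular if all nonzero maximal ($d \times d$) minors of $A$ have the same absolute value. For $A \in \mathbb{Z}^{d\times n}$ with columns $\mathbf{a}_1,\ldots,\mathbf{a}_n$, the centrally symmetric configuration $A^\pm \in \mathbb{Z}^{(d+1)\times(2n+1)}$ is the matrix whose columns are $$\begin{bmatrix}\mathbf{0}\\1\end{bmatrix},\ \begin{bmatrix}\mathbf{a}_1\\1\end{bmatrix},\ldots,\begin{bmatrix}\mathbf{a}_n\\1\end{bmatrix},\ \begin{bmatrix}-\mathbf{a}_1\\1\end{bmatrix},\ldots,\begin{bmatrix}-\mathbf{a}_n\\1\end{bmatrix}.$$ A configuration of $\mathbb{R}^e$ is an integer matrix $C\in\mathbb{Z}^{e\times m}$ whose columns $\mathbf{c}_1,\ldots,\mathbf{c}_m$ all lie on a hyperplane not passing through the origin ($A^\pm$ is a configuration of $\mathbb{R}^{d+1}$). Its toric ring $K[C]$ is the $K$-subalgebra of the Laurent polynomial ring $K[t_1^{\pm1},\ldots,t_e^{\pm1}]$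 generated by $\mathbf{t}^{\mathbf{c}_1},\ldots,\mathbf{t}^{\mathbf{c}_m}$, where $\mathbf{t}^{\mathbf{c}}=t_1^{c_1}\cdots t_e^{c_e}$, and its toric ideal $I_C\subset K[x_1,\ldots,x_m]$ is the kernel of the surjective $K$-algebra homomorphism $K[x_1,\ldots,x_m]\to K[C]$, $x_i\mapsto\mathbf{t}^{\mathbf{c}_i}$. A reverse lexicographic order is the graded reverse lexicographic monomial order induced by some ordering of the variables. *)

theory Defs
  imports "HOL-Analysis.Analysis" "HOL-Library.Poly_Mapping"
begin

(* Rows and columns of matrices are indexed by finite types, so a d x n matrix is an element of
   int ^ 'n ^ 'd with d = CARD('d) and n = CARD('n). *)

section \<open>Unimodular matrices and centrally symmetric configurations\<close>

(* An injection f selects d columns of A together with an order on them; the order only affects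
   the sign of the minor. *)
definition unimodular :: "int ^ 'n ^ 'd \<Rightarrow> bool" where
  "unimodular A \<longleftrightarrow>
     rank (map_matrix real_of_int A) = CARD('d) \<and>
     (\<forall>f g :: 'd \<Rightarrow> 'n. inj f \<longrightarrow> inj g \<longrightarrow>
        det (\<chi> i j. A $ i $ f j) \<noteq> 0 \<longrightarrow> det (\<chi> i j. A $ i $ g j) \<noteq> 0 \<longrightarrow>
        \<bar>det (\<chi> i j. A $ i $ f j)\<bar> = \<bar>det (\<chi> i j. A $ i $ g j)\<bar>)"

(* Row None is the additional last row. Column None is (0, 1), column Some (Inl j) is (a_j, 1)
   and column Some (Inr j) is (- a_j, 1). *)
definition centrally_symmetric :: "int ^ 'n ^ 'd \<Rightarrow> int ^ ('n + 'n) option ^ 'd option" where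
  "centrally_symmetric A =
     (\<chi> r c. case r of
        None \<Rightarrow> 1
      | Some i \<Rightarrow>
          (case c of
             None \<Rightarrow> 0
           | Some (Inl j) \<Rightarrow> A $ i $ j
           | Some (Inr j) \<Rightarrow> - (A $ i $ j)))"

section \<open>Polynomial rings and toric ideals\<close>

(* The polynomial ring with one variable for each element of 'v, and the Laurent polynomial ring
   with one variable for each element of 'e (the group algebra of the lattice int ^ 'e). *)
type_synonym ('v, 'k) polyn = "('v \<Rightarrow>\<^sub>0 nat) \<Rightarrow>\<^sub>0 'k"
type_synonym ('e, 'k) laurent = "(int ^ 'e) \<Rightarrow>\<^sub>0 'k"

definition laurent_monom :: "int ^ 'e \<Rightarrow> ('e, 'k::comm_ring_1) laurent" where
  "laurent_monom c = Poly_Mapping.single c 1"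

(* The K-algebra homomorphism with x_i \<mapsto> t^(c_i), where c_i is the i-th column of C. Its image is
   the toric ring K[C], so its kernel does not depend on whether the codomain is taken to be
   K[C] or the whole Laurent polynomial ring. *)
definition toric_hom :: "int ^ 'v ^ 'e \<Rightarrow> ('v::finite, 'k::comm_ring_1) polyn \<Rightarrow> ('e, 'k) laurent" where
  "toric_hom C p =
     (\<Sum>m \<in> Poly_Mapping.keys p.
        Poly_Mapping.single 0 (Poly_Mapping.lookup p m) *
        (\<Prod>i\<in>UNIV. laurent_monom (column i C) ^ Poly_Mapping.lookup m i))"

definition toric_ideal :: "int ^ 'v ^ 'e \<Rightarrow> ('v::finite, 'k::comm_ring_1) polyn set" where
  "toric_ideal C = {p. toric_hom C p = 0}"

section \<open>Ideals of commutative rings\<close>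

(* Ideals are the submodules of the ring regarded as a module over itself. *)
global_interpretation ring_ideal: module "(*) :: 'a::comm_ring_1 \<Rightarrow> 'a \<Rightarrow> 'a"
  defines is_ideal = ring_ideal.subspace
    and ideal_generated = ring_ideal.span
  by unfold_locales (simp_all add: algebra_simps)

definition is_radical_ideal :: "'a::comm_ring_1 set \<Rightarrow> bool" where
  "is_radical_ideal J \<longleftrightarrow> is_ideal J \<and> (\<forall>f. \<forall>k\<ge>1. f ^ k \<in> J \<longrightarrow> f \<in> J)"

section \<open>Reverse lexicographic orders and initial ideals\<close>

definition monom_degree :: "('v::finite \<Rightarrow>\<^sub>0 nat) \<Rightarrow> nat" where
  "monom_degree m = (\<Sum>i\<in>UNIV. Poly_Mapping.lookup m i)"

(* (j, i) \<in> r means that the variable x_j is smaller than the variable x_i. Among monomials of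
   equal degree, the one with the larger exponent at the smallest variable where the two differ
   is the smaller monomial. *)
definition grevlex_less :: "('v::finite) rel \<Rightarrow> ('v \<Rightarrow>\<^sub>0 nat) \<Rightarrow> ('v \<Rightarrow>\<^sub>0 nat) \<Rightarrow> bool" where
  "grevlex_less r u v \<longleftrightarrow>
     monom_degree u < monom_degree v \<or>
     (monom_degree u = monom_degree v \<and>
      (\<exists>i. Poly_Mapping.lookup u i > Poly_Mapping.lookup v i \<and>
           (\<forall>j. (j, i) \<in> r \<longrightarrow> Poly_Mapping.lookup u j = Poly_Mapping.lookup v j)))"

definition is_reverse_lex_order :: "(('v::finite \<Rightarrow>\<^sub>0 nat) \<Rightarrow> ('v \<Rightarrow>\<^sub>0 nat) \<Rightarrow> bool) \<Rightarrow> bool" where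
  "is_reverse_lex_order lt \<longleftrightarrow>
     (\<exists>r. strict_linear_order_on UNIV r \<and> lt = grevlex_less r)"

definition is_initial_monom ::
    "(('v \<Rightarrow>\<^sub>0 nat) \<Rightarrow> ('v \<Rightarrow>\<^sub>0 nat) \<Rightarrow> bool) \<Rightarrow> ('v, 'k::zero) polyn \<Rightarrow> ('v \<Rightarrow>\<^sub>0 nat) \<Rightarrow> bool" where
  "is_initial_monom lt f m \<longleftrightarrow>
     m \<in> Poly_Mapping.keys f \<and> (\<forall>m'\<in>Poly_Mapping.keys f. m' \<noteq> m \<longrightarrow> lt m' m)"

(* The zero polynomial has no initial monomial and hence contributes no generator. *)
definition initial_ideal ::
    "(('v \<Rightarrow>\<^sub>0 nat) \<Rightarrow> ('v \<Rightarrow>\<^sub>0 nat) \<Rightarrow> bool) \<Rightarrow> ('v, 'k::comm_ring_1) polyn set \<Rightarrow> ('v, 'k) polyn set" where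
  "initial_ideal lt I =
     ideal_generated {Poly_Mapping.single m 1 | m. \<exists>f\<in>I. is_initial_monom lt f m}"

end

theory Submission
  imports Defs
begin

text \<open>
  The order is the graded reverse lexicographic one in which the variable of the zero column is
  the smallest and the other variables are ordered arbitrarily.  A toric ideal is spanned by
  differences of monomials of equal multidegree, so a monomial lies in the initial ideal exactly
  if it is not the smallest monomial of its multidegree
  (\<open>initial_monoms_toric_ideal\<close>).  Hence the initial ideal is spanned by an upward closed set of
  monomials, and it is radical as soon as each monomial of that set has a squarefree divisor in
  the set (\<open>is_radical_ideal_monomials\<close>).

  To find such a divisor, let \<open>m'\<close> be smaller than \<open>m\<close> and of the same multidegree, and let \<open>x\<close> be
  the difference of their exponent vectors outside the zero column.  Then \<open>x\<close> lies in the kernel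
  of the matrix with columns \<open>a\<^sub>j\<close> and \<open>- a\<^sub>j\<close>, which is again unimodular.  By Cramer's rule, \<open>x\<close>
  is a sum of kernel vectors with entries \<open>0\<close>, \<open>1\<close>, \<open>-1\<close> whose signs agree with those of \<open>x\<close>.
  Therefore each linear functional that is positive on \<open>x\<close> is positive on one of these summands
  \<open>y\<close> (\<open>unimodular_kernel_conforming_positive\<close>).  The positive part of \<open>y\<close> is a squarefree divisor
  \<open>q\<close> of \<open>m\<close>.  If the entries of \<open>y\<close> have a nonnegative sum, the negative part of \<open>y\<close>, multiplied
  by a power of the variable of the zero column, is a monomial \<open>q'\<close> of the same multidegree as \<open>q\<close>.
  The functional is chosen so that the sum is indeed nonnegative and \<open>q'\<close> is smaller than \<open>q\<close>:
  a positive sum suffices because the variable of the zero column is the smallest one, and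
  if the sum is \<open>0\<close> then \<open>y\<close> takes the value \<open>-1\<close> at the smallest variable at which \<open>m\<close> and
  \<open>m'\<close> differ.  In geometric terms, pulling the origin first yields a unimodular triangulation.
\<close>

section \<open>Kernels of unimodular matrices\<close>

lemma det_map_matrix_of_int:
  "det (map_matrix real_of_int M) = real_of_int (det M)"
  by (simp add: det_def)

lemma kernel_sum_columns:
  fixes A :: "int ^ 'm ^ 'd"
  shows "A *v x = 0 \<longleftrightarrow>
    (\<Sum>i\<in>UNIV. real_of_int (x $ i) *\<^sub>R column i (map_matrix real_of_int A)) = 0"
proof -
  have "(A *v x) $ r = 0 \<longleftrightarrow>
    (\<Sum>i\<in>UNIV. real_of_int (x $ i) *\<^sub>R column i (map_matrix real_of_int A)) $ r = 0" for r
  proof -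
    have "(\<Sum>i\<in>UNIV. real_of_int (x $ i) *\<^sub>R column i (map_matrix real_of_int A)) $ r
        = real_of_int ((A *v x) $ r)"
      by (simp add: matrix_vector_mult_def column_def mult.commute)
    then show ?thesis by simp
  qed
  then show ?thesis by (simp add: vec_eq_iff)
qed

text \<open>
  Some column \<open>j\<close> in the support of \<open>x\<close> is a combination of other, linearly independent columns in
  that support.  After extending these to a basis of columns, the coefficients are quotients of two
  maximal minors by Cramer's rule, hence \<open>0\<close> or \<open>\<plusminus> 1\<close> by unimodularity.
\<close>

lemma unimodular_kernel_sign_vector:
  fixes A :: "int ^ 'm ^ 'd"
  assumes A: "unimodular A" and ker: "A *v x = 0" and "x \<noteq> 0"
  obtains y where "A *v y = 0" "y \<noteq> 0" "\<And>i. y $ i \<in> {-1, 0, 1}" "\<And>i. y $ i \<noteq> 0 \<Longrightarrow> x $ i \<noteq> 0"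
proof -
  define R where "R = map_matrix real_of_int A"
  define S where "S = {i. x $ i \<noteq> 0}"
  let ?col = "\<lambda>i. column i R"
  have rank: "rank R = CARD('d)"
    using A by (simp add: unimodular_def R_def)
  have sumx: "(\<Sum>i\<in>S. real_of_int (x $ i) *\<^sub>R ?col i) = 0"
    using ker unfolding kernel_sum_columns R_def S_def
    by (subst sum.mono_neutral_left[of UNIV]) auto
  obtain B0 where B0: "B0 \<subseteq> ?col ` S" "independent B0" "?col ` S \<subseteq> span B0"
    using maximal_independent_subset by blast
  obtain B where B: "B0 \<subseteq> B" "B \<subseteq> range ?col" "independent B" "range ?col \<subseteq> span B"
    using maximal_independent_subset_extend[of B0 "range ?col"] B0 by blast
  have "columns R = range ?col"
    by (auto simp: columns_def)
  then have cardB: "card B = CARD('d)"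
    using basis_card_eq_dim[OF B(2,4,3)] rank by (simp add: column_rank_def)
  have finB: "finite B"
    using B(3) by (rule finiteI_independent)
  then have finB0: "finite B0" using B(1) finite_subset by blast
  obtain g where g: "bij_betw g (UNIV :: 'd set) B"
    using finite_same_card_bij[OF finite finB] cardB by metis
  \<comment> \<open>Distinct indices may carry equal columns; basis vectors in \<open>B0\<close> get an index in the support of \<open>x\<close>.\<close>
  define rep where "rep b = (if b \<in> B0 then inv_into S ?col b else inv_into UNIV ?col b)" for b
  have col_rep: "?col (rep b) = b" if "b \<in> B" for b
    using that B0(1) B(2) by (auto simp: rep_def intro!: f_inv_into_f)
  have rep_S: "rep b \<in> S" if "b \<in> B0" for b
    using that B0(1) unfolding rep_def by (auto intro!: inv_into_into)
  \<comment> \<open>Otherwise all columns in the support of \<open>x\<close> would be independent, contradicting \<open>sumx\<close>.\<close>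
  obtain j where j: "j \<in> S" "j \<notin> rep ` B0"
  proof (rule ccontr)
    assume "\<not> thesis"
    then have S: "S \<subseteq> rep ` B0" using that by blast
    have inj: "inj_on ?col S"
      by (rule inj_on_subset[OF _ S]) (use col_rep B(1) in \<open>auto simp: inj_on_def subset_iff\<close>)
    have sub: "?col ` S \<subseteq> B0"
    proof
      fix v assume "v \<in> ?col ` S"
      then obtain b where "b \<in> B0" "v = ?col (rep b)" using S by blast
      then show "v \<in> B0" using col_rep B(1) by auto
    qed
    obtain i where i: "i \<in> S" using \<open>x \<noteq> 0\<close> by (auto simp: S_def vec_eq_iff)
    have "(\<Sum>b\<in>?col ` S. real_of_int (x $ inv_into S ?col b) *\<^sub>R b) = 0"
      using sumx by (simp add: sum.reindex[OF inj] inv_into_f_f[OF inj])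
    from independentD[OF B0(2) _ sub this, of "?col i"] i inj
    have "x $ i = 0" by (simp add: inv_into_f_f[OF inj])
    then show False using i by (simp add: S_def)
  qed
  have "?col j \<in> span B0" using j B0(3) by blast
  then obtain \<mu> where \<mu>: "?col j = (\<Sum>b\<in>B0. \<mu> b *\<^sub>R b)"
    unfolding span_finite[OF finB0] by auto
  define f where "f k = rep (g k)" for k
  define l where "l k = (if g k \<in> B0 then \<mu> (g k) else 0)" for k
  have gB: "g k \<in> B" for k using g by (auto simp: bij_betw_def)
  have col_f: "?col (f k) = g k" for k
    by (simp add: f_def col_rep gB)
  have inj_f: "inj f"
    using col_f g by (metis bij_betw_def injD injI)
  have "(\<Sum>k\<in>UNIV. l k *\<^sub>R ?col (f k)) = (\<Sum>b\<in>B. (if b \<in> B0 then \<mu> b else 0) *\<^sub>R b)"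
    unfolding col_f l_def
    by (rule sum.reindex_bij_betw[OF g, of "\<lambda>b. (if b \<in> B0 then \<mu> b else 0) *\<^sub>R b"])
  also have "\<dots> = ?col j"
    unfolding \<mu> using finB B(1) by (intro sum.mono_neutral_cong_right) auto
  finally have suml: "(\<Sum>k\<in>UNIV. l k *\<^sub>R ?col (f k)) = ?col j" .
  define M where "M h = (\<chi> r k. A $ r $ h k)" for h :: "'d \<Rightarrow> 'm"
  define N where "N h = (\<chi> r k. R $ r $ h k)" for h :: "'d \<Rightarrow> 'm"
  have detN: "det (N h) = real_of_int (det (M h))" for h
  proof -
    have "N h = map_matrix real_of_int (M h)"
      by (simp add: N_def M_def R_def vec_eq_iff)
    then show ?thesis by (simp add: det_map_matrix_of_int)
  qed
  have det_f: "det (N f) \<noteq> 0"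
  proof -
    have "columns (N f) = B"
    proof -
      have "column k (N f) = g k" for k
        using col_f[of k] by (simp add: N_def column_def)
      then show ?thesis using g by (auto simp: columns_def bij_betw_def)
    qed
    then have "rank (N f) = CARD('d)"
      using dim_eq_card_independent[OF B(3)] cardB by (simp add: column_rank_def)
    then show ?thesis using det_eq_0_rank[of "N f"] by simp
  qed
  have "N f *v (\<chi> k. l k) = ?col j"
    using suml by (simp add: matrix_vector_mult_def N_def vec_eq_iff column_def mult.commute)
  then have "(\<chi> k. l k) = (\<chi> k. det (\<chi> r i. if i = k then ?col j $ r else N f $ r $ i) / det (N f))"
    using cramer[OF det_f] by blast
  moreover have "(\<chi> r i. if i = k then ?col j $ r else N f $ r $ i) = N (f(k := j))" for k
    by (simp add: N_def column_def vec_eq_iff)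
  ultimately have l: "l k = det (N (f(k := j))) / det (N f)" for k
    by (simp add: vec_eq_iff)
  have "\<exists>c::int. c \<in> {-1, 0, 1} \<and> l k = real_of_int c" for k
  proof (cases "det (M (f(k := j))) = 0")
    case True
    then show ?thesis by (simp add: l detN)
  next
    case False
    have "inj (f(k := j))"
    proof (rule ccontr)
      assume "\<not> ?thesis"
      then obtain a b where "a \<noteq> b" "(f(k := j)) a = (f(k := j)) b"
        by (auto simp: inj_def)
      then have "det (M (f(k := j))) = 0"
        by (intro det_identical_columns[of a b]) (simp_all add: M_def column_def)
      then show False using False by simp
    qed
    moreover have "det (M f) \<noteq> 0" using det_f by (simp add: detN)
    ultimately have "\<bar>det (M (f(k := j)))\<bar> = \<bar>det (M f)\<bar>"
      using A inj_f False unfolding unimodular_def M_def by blast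
    then have "det (M (f(k := j))) = det (M f) \<or> det (M (f(k := j))) = - det (M f)"
      by linarith
    then have "l k = 1 \<or> l k = -1"
      using \<open>det (M f) \<noteq> 0\<close> by (auto simp: l detN)
    then show ?thesis by (metis insertCI of_int_1 of_int_minus)
  qed
  then obtain c where c: "\<And>k. c k \<in> {-1, 0, 1 :: int}" "\<And>k. l k = real_of_int (c k)"
    by metis
  have c_supp: "f k \<in> S - {j}" if "c k \<noteq> 0" for k
  proof -
    have "l k \<noteq> 0" using that c(2) by simp
    then have "g k \<in> B0" by (auto simp: l_def split: if_splits)
    then show ?thesis using rep_S j(2) by (auto simp: f_def)
  qed
  define y :: "int ^ 'm" where
    "y = (\<chi> i. (if i = j then 1 else 0) - (\<Sum>k\<in>UNIV. if f k = i then c k else 0))"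
  have y_j: "y $ j = 1"
  proof -
    have "(\<Sum>k\<in>UNIV. if f k = j then c k else 0) = 0"
      using c_supp by (intro sum.neutral) auto
    then show ?thesis by (simp add: y_def)
  qed
  have y_f: "y $ f k = - c k" if "f k \<noteq> j" for k
    using that inj_f by (simp add: y_def inj_eq)
  have y_0: "y $ i = 0" if "i \<noteq> j" "i \<notin> range f" for i
    using that by (auto simp: y_def intro!: sum.neutral)
  have "A *v y = 0"
  proof -
    have "(\<Sum>i\<in>UNIV. real_of_int (y $ i) *\<^sub>R ?col i) =
       ?col j - (\<Sum>i\<in>UNIV. \<Sum>k\<in>UNIV. if f k = i then l k *\<^sub>R ?col i else 0)"
      by (simp add: y_def scaleR_diff_left sum_subtractf if_distrib[of "\<lambda>t. t *\<^sub>R _"] if_distrib[of real_of_int]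
          scaleR_sum_left c(2) cong: if_cong)
    also have "\<dots> = 0"
      by (subst sum.swap) (simp add: suml)
    finally show ?thesis
      unfolding kernel_sum_columns R_def .
  qed
  moreover have "y \<noteq> 0" using y_j by auto
  moreover have "y $ i \<in> {-1, 0, 1} \<and> (y $ i \<noteq> 0 \<longrightarrow> x $ i \<noteq> 0)" for i
  proof -
    consider "i = j" | k where "i \<noteq> j" "i = f k" | "i \<noteq> j" "i \<notin> range f" by blast
    then show ?thesis
    proof cases
      case 1
      then show ?thesis using y_j j(1) by (simp add: S_def)
    next
      case 2
      then show ?thesis using y_f[of k] c(1)[of k] c_supp[of k] by (auto simp: S_def)
    next
      case 3
      then show ?thesis using y_0 by simp
    qed
  qed
  ultimately show ?thesis using that by blast
qed

definition sign_conforms :: "int ^ 'm \<Rightarrow> int ^ 'm \<Rightarrow> bool" where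
  "sign_conforms y x \<longleftrightarrow> (\<forall>i. y $ i = 0 \<or> y $ i = 1 \<and> x $ i > 0 \<or> y $ i = -1 \<and> x $ i < 0)"

text \<open>
  Let \<open>z\<close> be a kernel vector with entries \<open>0\<close>, \<open>1\<close>, \<open>-1\<close> in the support of \<open>x\<close> that agrees in sign
  with \<open>x\<close> somewhere.  Subtract from \<open>x\<close> the largest multiple of \<open>z\<close> that creates no sign change.
  Either nothing remains, so that \<open>z\<close> conforms to \<open>x\<close>, or the support becomes smaller while the
  signs that remain are those of \<open>x\<close>.
\<close>

lemma unimodular_kernel_conforming_vector:
  fixes A :: "int ^ 'm ^ 'd"
  assumes A: "unimodular A" and "A *v x = 0" and "x \<noteq> 0"
  shows "\<exists>y. A *v y = 0 \<and> y \<noteq> 0 \<and> sign_conforms y x"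
  using assms(2,3)
proof (induction "card {i. x $ i \<noteq> 0}" arbitrary: x rule: less_induct)
  case less
  obtain y where y: "A *v y = 0" "y \<noteq> 0" "\<And>i. y $ i \<in> {-1, 0, 1}" "\<And>i. y $ i \<noteq> 0 \<Longrightarrow> x $ i \<noteq> 0"
    using unimodular_kernel_sign_vector[OF A less.prems] by blast
  obtain z where z: "A *v z = 0" "z \<noteq> 0" "\<And>i. z $ i \<in> {-1, 0, 1}" "\<And>i. z $ i \<noteq> 0 \<Longrightarrow> x $ i \<noteq> 0"
    and pos: "\<exists>i. z $ i * x $ i > 0"
  proof (cases "\<exists>i. y $ i * x $ i > 0")
    case True
    then show ?thesis using y that by blast
  next
    case False
    obtain i where "y $ i \<noteq> 0" using y(2) by (auto simp: vec_eq_iff)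
    with y(4) False have "(- y) $ i * x $ i > 0"
      by (metis linorder_neqE_linordered_idom mult_eq_0_iff mult_minus_left neg_0_less_iff_less vector_uminus_component)
    moreover have "A *v (- y) = 0"
      using y(1) by (metis diff_0 matrix_vector_mult_0_right matrix_vector_mult_diff_distrib minus_zero)
    moreover have "(- y) $ i \<in> {-1, 0, 1}" for i using y(3)[of i] by auto
    ultimately show ?thesis using y that[of "- y"] by fastforce
  qed
  \<comment> \<open>Only entries in \<open>P\<close> shrink when a multiple of \<open>z\<close> is subtracted, and \<open>t\<close> is the first time one vanishes.\<close>
  define P where "P = {i. z $ i * x $ i > 0}"
  define t where "t = Min ((\<lambda>i. \<bar>x $ i\<bar>) ` P)"
  have "t \<in> (\<lambda>i. \<bar>x $ i\<bar>) ` P"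
    unfolding t_def using pos by (intro Min_in) (auto simp: P_def)
  then obtain p where p: "p \<in> P" "t = \<bar>x $ p\<bar>" by blast
  have t_le: "t \<le> \<bar>x $ i\<bar>" if "i \<in> P" for i
    unfolding t_def using that by (intro Min_le) auto
  have "t > 0" using p by (auto simp: P_def)
  define x' where "x' = x - t *s z"
  have "(A *v (t *s z)) $ r = t * (A *v z) $ r" for r
    unfolding matrix_vector_mult_def
    by (simp add: sum_distrib_left) (intro sum.cong refl, simp)
  then have "A *v (t *s z) = 0"
    using z(1) by (simp add: vec_eq_iff)
  then have ker': "A *v x' = 0"
    using less.prems z(1) by (simp add: x'_def matrix_vector_mult_diff_distrib)
  have x'_i: "x' $ i = x $ i - t * z $ i" for i
    by (simp add: x'_def)
  have x'_sign: "(x' $ i > 0 \<longrightarrow> x $ i > 0) \<and> (x' $ i < 0 \<longrightarrow> x $ i < 0)" for i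
  proof -
    have "z $ i = 0 \<or> z $ i = 1 \<or> z $ i = -1" using z(3)[of i] by blast
    then show ?thesis
    proof (elim disjE)
      assume "z $ i = 0"
      then show ?thesis using x'_i[of i] by simp
    next
      assume zi: "z $ i = 1"
      then have "x' $ i = x $ i - t" using x'_i[of i] by simp
      moreover have "x $ i \<noteq> 0" using zi z(4)[of i] by simp
      moreover have "t \<le> x $ i" if "x $ i > 0" using that zi t_le[of i] by (simp add: P_def)
      ultimately show ?thesis using \<open>t > 0\<close> by linarith
    next
      assume zi: "z $ i = -1"
      then have "x' $ i = x $ i + t" using x'_i[of i] by simp
      moreover have "x $ i \<noteq> 0" using zi z(4)[of i] by simp
      moreover have "t \<le> - x $ i" if "x $ i < 0" using that zi t_le[of i] by (simp add: P_def)
      ultimately show ?thesis using \<open>t > 0\<close> by linarith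
    qed
  qed
  have p_pos: "z $ p * x $ p > 0" using p(1) by (simp add: P_def)
  have x'_p: "x' $ p = 0"
  proof -
    have "z $ p = 0 \<or> z $ p = 1 \<or> z $ p = -1" using z(3)[of p] by blast
    then show ?thesis
      using p_pos p(2) by (elim disjE) (simp_all add: x'_i)
  qed
  show ?case
  proof (cases "x' = 0")
    case True
    then have x_eq: "x $ i = t * z $ i" for i
      using x'_i[of i] by simp
    have "sign_conforms z x"
      unfolding sign_conforms_def
    proof
      fix i
      have "z $ i = 0 \<or> z $ i = 1 \<or> z $ i = -1" using z(3)[of i] by blast
      then show "z $ i = 0 \<or> z $ i = 1 \<and> x $ i > 0 \<or> z $ i = -1 \<and> x $ i < 0"
        using x_eq[of i] \<open>t > 0\<close> by (elim disjE) simp_all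
    qed
    then show ?thesis using z by blast
  next
    case False
    have "x $ i \<noteq> 0" if "x' $ i \<noteq> 0" for i
      using x'_sign[of i] that by linarith
    moreover have "x $ p \<noteq> 0" using p_pos by auto
    ultimately have "{i. x' $ i \<noteq> 0} \<subset> {i. x $ i \<noteq> 0}"
      using x'_p by blast
    then have "card {i. x' $ i \<noteq> 0} < card {i. x $ i \<noteq> 0}"
      by (intro psubset_card_mono) auto
    then obtain w where w: "A *v w = 0" "w \<noteq> 0" "sign_conforms w x'"
      using less.hyps[OF _ ker' False] by blast
    have "sign_conforms w x"
      using w(3) x'_sign unfolding sign_conforms_def by blast
    then show ?thesis using w by blast
  qed
qed

text \<open>
  This is the form in which the conformal decomposition of \<open>x\<close> is used: if the functional \<open>c\<close> is
  not positive on a conforming vector \<open>y\<close>, it is still positive on \<open>x - y\<close>, which is closer to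
  \<open>0\<close>, and whatever conforms to \<open>x - y\<close> conforms to \<open>x\<close>.
\<close>

lemma unimodular_kernel_conforming_positive:
  fixes A :: "int ^ 'm ^ 'd" and c :: "int ^ 'm"
  assumes A: "unimodular A" and "A *v x = 0" and "(\<Sum>i\<in>UNIV. c $ i * x $ i) > 0"
  shows "\<exists>y. A *v y = 0 \<and> sign_conforms y x \<and> (\<Sum>i\<in>UNIV. c $ i * y $ i) > 0"
  using assms(2,3)
proof (induction "nat (\<Sum>i\<in>UNIV. \<bar>x $ i\<bar>)" arbitrary: x rule: less_induct)
  case less
  have "x \<noteq> 0" using less.prems(2) by auto
  then obtain y where y: "A *v y = 0" "y \<noteq> 0" "sign_conforms y x"
    using unimodular_kernel_conforming_vector[OF A less.prems(1)] by blast
  show ?case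
  proof (cases "(\<Sum>i\<in>UNIV. c $ i * y $ i) > 0")
    case True
    then show ?thesis using y by blast
  next
    case False
    have le: "\<bar>(x - y) $ i\<bar> \<le> \<bar>x $ i\<bar>" for i
      using y(3)[unfolded sign_conforms_def, rule_format, of i] by auto
    obtain i where i: "y $ i \<noteq> 0" using y(2) by (auto simp: vec_eq_iff)
    then have "\<bar>(x - y) $ i\<bar> < \<bar>x $ i\<bar>"
      using y(3)[unfolded sign_conforms_def, rule_format, of i] by auto
    then have "(\<Sum>i\<in>UNIV. \<bar>(x - y) $ i\<bar>) < (\<Sum>i\<in>UNIV. \<bar>x $ i\<bar>)"
      using le by (intro sum_strict_mono_ex1) auto
    moreover have "(\<Sum>i\<in>UNIV. \<bar>(x - y) $ i\<bar>) \<ge> 0" by (intro sum_nonneg) auto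
    ultimately have "nat (\<Sum>i\<in>UNIV. \<bar>(x - y) $ i\<bar>) < nat (\<Sum>i\<in>UNIV. \<bar>x $ i\<bar>)" by linarith
    moreover have "A *v (x - y) = 0"
      using y(1) less.prems(1) by (simp add: matrix_vector_mult_diff_distrib)
    moreover have "(\<Sum>i\<in>UNIV. c $ i * (x - y) $ i) > 0"
      using False less.prems(2) by (simp add: right_diff_distrib sum_subtractf)
    ultimately obtain w where w: "A *v w = 0" "sign_conforms w (x - y)" "(\<Sum>i\<in>UNIV. c $ i * w $ i) > 0"
      using less.hyps by blast
    have "sign_conforms w x"
      using w(2) y(3) unfolding sign_conforms_def by (smt (verit) vector_minus_component)
    then show ?thesis using w by blast
  qed
qed

definition signed_columns :: "int ^ 'n ^ 'd \<Rightarrow> int ^ ('n + 'n) ^ 'd" where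
  "signed_columns A = (\<chi> r c. case c of Inl j \<Rightarrow> A $ r $ j | Inr j \<Rightarrow> - (A $ r $ j))"

text \<open>
  Up to sign, a maximal minor of \<open>signed_columns A\<close> is a maximal minor of \<open>A\<close>, or zero if it uses
  both signs of one column.
\<close>

lemma unimodular_signed_columns:
  fixes A :: "int ^ 'n ^ 'd"
  assumes A: "unimodular A"
  shows "unimodular (signed_columns A)"
proof -
  define p :: "'n + 'n \<Rightarrow> 'n" where "p c = (case c of Inl j \<Rightarrow> j | Inr j \<Rightarrow> j)" for c
  define s :: "'n + 'n \<Rightarrow> int" where "s c = (case c of Inl j \<Rightarrow> 1 | Inr j \<Rightarrow> -1)" for c
  define M where "M h = (\<chi> r k. A $ r $ h k)" for h :: "'d \<Rightarrow> 'n"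
  have entry: "signed_columns A $ r $ c = s c * A $ r $ p c" for r c
    by (cases c) (simp_all add: signed_columns_def p_def s_def)
  have minor: "\<bar>det (\<chi> r k. signed_columns A $ r $ f k)\<bar> = \<bar>det (M (p \<circ> f))\<bar>" for f :: "'d \<Rightarrow> 'n + 'n"
  proof -
    have "det (\<chi> r k. signed_columns A $ r $ f k) = det (transpose (\<chi> r k. signed_columns A $ r $ f k))"
      by (simp add: det_transpose)
    also have "transpose (\<chi> r k. signed_columns A $ r $ f k) = (\<chi> k. s (f k) *s transpose (M (p \<circ> f)) $ k)"
      by (simp add: transpose_def entry M_def vec_eq_iff)
    also have "det \<dots> = (\<Prod>k\<in>UNIV. s (f k)) * det (M (p \<circ> f))"
      using det_rows_mul[of "\<lambda>k. s (f k)" "\<lambda>k. transpose (M (p \<circ> f)) $ k"]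
      by (simp add: det_transpose)
    finally have "\<bar>det (\<chi> r k. signed_columns A $ r $ f k)\<bar>
        = (\<Prod>k\<in>UNIV. \<bar>s (f k)\<bar>) * \<bar>det (M (p \<circ> f))\<bar>"
      by (simp add: abs_mult abs_prod)
    moreover have "\<bar>s c\<bar> = 1" for c by (cases c) (simp_all add: s_def)
    ultimately show ?thesis by simp
  qed
  have inj: "inj (p \<circ> f)" if "det (M (p \<circ> f)) \<noteq> 0" for f :: "'d \<Rightarrow> 'n + 'n"
  proof (rule ccontr)
    assume "\<not> ?thesis"
    then obtain a b where "a \<noteq> b" "(p \<circ> f) a = (p \<circ> f) b" by (auto simp: inj_def)
    then have "det (M (p \<circ> f)) = 0"
      by (intro det_identical_columns[of a b]) (simp_all add: M_def column_def)
    then show False using that by simp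
  qed
  have "rank (map_matrix real_of_int (signed_columns A)) = CARD('d)"
  proof -
    have "columns (map_matrix real_of_int A) \<subseteq> columns (map_matrix real_of_int (signed_columns A))"
    proof
      fix v assume "v \<in> columns (map_matrix real_of_int A)"
      then obtain j where "v = column j (map_matrix real_of_int A)" by (auto simp: columns_def)
      then have "v = column (Inl j) (map_matrix real_of_int (signed_columns A))"
        by (simp add: column_def signed_columns_def vec_eq_iff)
      then show "v \<in> columns (map_matrix real_of_int (signed_columns A))"
        by (auto simp: columns_def)
    qed
    then have "CARD('d) \<le> rank (map_matrix real_of_int (signed_columns A))"
      using A dim_subset unfolding unimodular_def column_rank_def by metis
    moreover have "rank (map_matrix real_of_int (signed_columns A)) \<le> CARD('d)"
      using rank_bound[of "map_matrix real_of_int (signed_columns A)"] by simp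
    ultimately show ?thesis by simp
  qed
  moreover have "\<bar>det (M (p \<circ> f))\<bar> = \<bar>det (M (p \<circ> g))\<bar>"
    if "det (M (p \<circ> f)) \<noteq> 0" "det (M (p \<circ> g)) \<noteq> 0" for f g :: "'d \<Rightarrow> 'n + 'n"
    using A that inj[OF that(1)] inj[OF that(2)] unfolding unimodular_def M_def by blast
  ultimately show ?thesis
    unfolding unimodular_def using minor by (metis abs_eq_0)
qed

section \<open>The graded reverse lexicographic order\<close>

lemma monom_degree_add: "monom_degree (u + v) = monom_degree u + monom_degree v"
  by (simp add: monom_degree_def lookup_add sum.distrib)

lemma grevlex_less_irrefl: "\<not> grevlex_less r u u"
  by (simp add: grevlex_less_def)

lemma grevlex_less_add_right: "grevlex_less r (u + w) (v + w) \<longleftrightarrow> grevlex_less r u v"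
  by (simp add: grevlex_less_def monom_degree_add lookup_add)

lemma grevlex_less_add_left: "grevlex_less r (w + u) (w + v) \<longleftrightarrow> grevlex_less r u v"
  using grevlex_less_add_right[of r u w v] by (simp add: add.commute)

lemma grevlex_less_trans:
  assumes r: "strict_linear_order_on UNIV r"
    and uv: "grevlex_less r u v" and vw: "grevlex_less r v w"
  shows "grevlex_less r u w"
proof (cases "monom_degree u = monom_degree v \<and> monom_degree v = monom_degree w")
  case False
  then show ?thesis using uv vw by (auto simp: grevlex_less_def)
next
  case True
  obtain a where a: "Poly_Mapping.lookup u a > Poly_Mapping.lookup v a" "\<And>j. (j, a) \<in> r \<Longrightarrow> Poly_Mapping.lookup u j = Poly_Mapping.lookup v j"
    using uv True by (auto simp: grevlex_less_def)
  obtain b where b: "Poly_Mapping.lookup v b > Poly_Mapping.lookup w b" "\<And>j. (j, b) \<in> r \<Longrightarrow> Poly_Mapping.lookup v j = Poly_Mapping.lookup w j"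
    using vw True by (auto simp: grevlex_less_def)
  have trans: "trans r" and "total r"
    using r by (auto simp: strict_linear_order_on_def)
  then consider "a = b" | "(a, b) \<in> r" | "(b, a) \<in> r"
    by (auto simp: total_on_def)
  then have "\<exists>i. Poly_Mapping.lookup u i > Poly_Mapping.lookup w i \<and> (\<forall>j. (j, i) \<in> r \<longrightarrow> Poly_Mapping.lookup u j = Poly_Mapping.lookup w j)"
  proof cases
    case 1
    then show ?thesis using a b by (metis order.strict_trans)
  next
    case 2
    then show ?thesis using a b transD[OF trans _ 2] by metis
  next
    case 3
    then show ?thesis using a b transD[OF trans _ 3] by metis
  qed
  then show ?thesis using True by (simp add: grevlex_less_def)
qed

lemma grevlex_less_total:
  assumes r: "strict_linear_order_on UNIV r" and "u \<noteq> v"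
  shows "grevlex_less r u v \<or> grevlex_less r v u"
proof -
  define D where "D = {i. Poly_Mapping.lookup u i \<noteq> Poly_Mapping.lookup v i}"
  have "D \<noteq> {}"
    using \<open>u \<noteq> v\<close> poly_mapping_eqI[of u v] by (auto simp: D_def)
  have "trans r" "irrefl r"
    using r by (simp_all add: strict_linear_order_on_def)
  then have "transp_on D (\<lambda>x y. (x, y) \<in> r)" "asymp_on D (\<lambda>x y. (x, y) \<in> r)"
    unfolding transp_on_def asymp_on_def trans_def irrefl_def by blast+
  with \<open>D \<noteq> {}\<close> obtain i where i: "i \<in> D" "\<And>j. j \<in> D \<Longrightarrow> j \<noteq> i \<Longrightarrow> (j, i) \<notin> r"
    using Finite_Set.bex_min_element[of D "\<lambda>x y. (x, y) \<in> r"] by auto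
  then have "Poly_Mapping.lookup u j = Poly_Mapping.lookup v j" if "(j, i) \<in> r" for j
    using that \<open>irrefl r\<close> by (auto simp: D_def irrefl_def)
  moreover have "Poly_Mapping.lookup u i < Poly_Mapping.lookup v i \<or> Poly_Mapping.lookup v i < Poly_Mapping.lookup u i"
    using i(1) by (auto simp: D_def)
  ultimately show ?thesis unfolding grevlex_less_def by (metis linorder_neqE_nat)
qed

lemma strict_linear_order_on_measure:
  fixes h :: "'v \<Rightarrow> nat"
  assumes "inj h"
  shows "strict_linear_order_on UNIV {(j, i). h j < h i}"
  unfolding strict_linear_order_on_def
proof (intro conjI)
  show "total {(j, i). h j < h i}"
    using assms by (auto simp: total_on_def) (metis injD linorder_neqE_nat)
qed (auto simp: trans_def irrefl_def)

section \<open>Radical monomial ideals\<close>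

lemma ex_initial_monom:
  assumes r: "strict_linear_order_on UNIV r" and "f \<noteq> 0"
  shows "\<exists>m. is_initial_monom (grevlex_less r) f m"
proof -
  have "asymp_on (Poly_Mapping.keys f) (grevlex_less r)"
    by (rule asymp_onI) (metis grevlex_less_trans[OF r] grevlex_less_irrefl)
  moreover have "transp_on (Poly_Mapping.keys f) (grevlex_less r)"
    by (rule transp_onI) (metis grevlex_less_trans[OF r])
  ultimately obtain m where "m \<in> Poly_Mapping.keys f"
      "\<And>x. x \<in> Poly_Mapping.keys f \<Longrightarrow> x \<noteq> m \<Longrightarrow> \<not> grevlex_less r m x"
    using Finite_Set.bex_max_element[of "Poly_Mapping.keys f" "grevlex_less r"] \<open>f \<noteq> 0\<close> by auto
  then show ?thesis
    unfolding is_initial_monom_def using grevlex_less_total[OF r] by metis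
qed

lemma keys_multE:
  assumes "w \<in> Poly_Mapping.keys (f * g)"
  obtains u v where "u \<in> Poly_Mapping.keys f" "v \<in> Poly_Mapping.keys g" "w = u + v"
proof -
  have "\<exists>u v. w = u + v \<and> u \<in> Poly_Mapping.keys f \<and> v \<in> Poly_Mapping.keys g"
    using subsetD[OF keys_mult assms] by (simp only: mem_Collect_eq)
  then show thesis using that by blast
qed

lemma is_initial_monom_mult:
  fixes f g :: "('v::finite, 'k::idom) polyn"
  assumes r: "strict_linear_order_on UNIV r"
    and f: "is_initial_monom (grevlex_less r) f a" and g: "is_initial_monom (grevlex_less r) g b"
  shows "is_initial_monom (grevlex_less r) (f * g) (a + b)"
proof -
  let ?lt = "grevlex_less r"
  have less: "?lt (u + v) (a + b)"
    if "u \<in> Poly_Mapping.keys f" "v \<in> Poly_Mapping.keys g" "u \<noteq> a \<or> v \<noteq> b" for u v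
  proof -
    have "u = a \<or> ?lt u a" "v = b \<or> ?lt v b"
      using f g that by (auto simp: is_initial_monom_def)
    then have "u + v = a + v \<or> ?lt (u + v) (a + v)" "a + v = a + b \<or> ?lt (a + v) (a + b)"
      by (auto simp: grevlex_less_add_left grevlex_less_add_right)
    then show ?thesis
      using that(3) grevlex_less_trans[OF r, of "u + v" "a + v" "a + b"] by auto
  qed
  let ?c = "Poly_Mapping.lookup f a" and ?d = "Poly_Mapping.lookup g b"
  define f' where "f' = f - Poly_Mapping.single a ?c"
  define g' where "g' = g - Poly_Mapping.single b ?d"
  have f': "Poly_Mapping.keys f' \<subseteq> Poly_Mapping.keys f - {a}"
    by (auto simp: f'_def in_keys_iff lookup_minus lookup_single when_def split: if_splits)
  have g': "Poly_Mapping.keys g' \<subseteq> Poly_Mapping.keys g - {b}"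
    by (auto simp: g'_def in_keys_iff lookup_minus lookup_single when_def split: if_splits)
  have a: "a \<in> Poly_Mapping.keys f" and b: "b \<in> Poly_Mapping.keys g"
    using f g by (auto simp: is_initial_monom_def)
  have "f * g = Poly_Mapping.single (a + b) (?c * ?d) + (Poly_Mapping.single a ?c * g' + f' * g)"
    by (simp add: f'_def g'_def algebra_simps mult_single)
  moreover have "a + b \<notin> Poly_Mapping.keys (Poly_Mapping.single a ?c * g')"
  proof
    assume "a + b \<in> Poly_Mapping.keys (Poly_Mapping.single a ?c * g')"
    then obtain u v where "u \<in> Poly_Mapping.keys (Poly_Mapping.single a ?c)"
        "v \<in> Poly_Mapping.keys g'" "a + b = u + v"
      by (rule keys_multE)
    then show False using g' by (auto split: if_splits)
  qed
  moreover have "a + b \<notin> Poly_Mapping.keys (f' * g)"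
  proof
    assume "a + b \<in> Poly_Mapping.keys (f' * g)"
    then obtain u v where "u \<in> Poly_Mapping.keys f'" "v \<in> Poly_Mapping.keys g" "a + b = u + v"
      by (rule keys_multE)
    then have "?lt (u + v) (a + b)" using f' by (intro less) auto
    then show False using \<open>a + b = u + v\<close> by (simp add: grevlex_less_irrefl)
  qed
  ultimately have "Poly_Mapping.lookup (f * g) (a + b) = ?c * ?d"
    by (simp add: lookup_add in_keys_iff)
  moreover have "?c * ?d \<noteq> 0" using a b by (simp add: in_keys_iff)
  ultimately have "a + b \<in> Poly_Mapping.keys (f * g)" by (simp add: in_keys_iff)
  moreover have "?lt w (a + b)" if "w \<in> Poly_Mapping.keys (f * g)" "w \<noteq> a + b" for w
  proof -
    from that(1) obtain u v where "u \<in> Poly_Mapping.keys f" "v \<in> Poly_Mapping.keys g" "w = u + v"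
      by (rule keys_multE)
    then show ?thesis using less that(2) by blast
  qed
  ultimately show ?thesis by (simp add: is_initial_monom_def)
qed

lemma is_initial_monom_power:
  fixes f :: "('v::finite, 'k::idom) polyn"
  assumes r: "strict_linear_order_on UNIV r" and f: "is_initial_monom (grevlex_less r) f m"
  shows "\<exists>w. is_initial_monom (grevlex_less r) (f ^ k) w \<and> (\<forall>i. Poly_Mapping.lookup w i = k * Poly_Mapping.lookup m i)"
proof (induction k)
  case 0
  have "is_initial_monom (grevlex_less r) (1 :: ('v, 'k) polyn) 0"
    by (simp add: is_initial_monom_def)
  then show ?case by (intro exI[of _ 0]) simp
next
  case (Suc k)
  then obtain w where "is_initial_monom (grevlex_less r) (f ^ k) w" "\<And>i. Poly_Mapping.lookup w i = k * Poly_Mapping.lookup m i"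
    by blast
  then show ?case
    using is_initial_monom_mult[OF r f] by (intro exI[of _ "m + w"]) (simp add: lookup_add)
qed

definition monomial_upset :: "('v \<Rightarrow>\<^sub>0 nat) set \<Rightarrow> bool" where
  "monomial_upset M \<longleftrightarrow> (\<forall>m\<in>M. \<forall>a. a + m \<in> M)"

lemma is_ideal_keys_subset:
  assumes "monomial_upset M"
  shows "is_ideal {f :: ('v, 'k::comm_ring_1) polyn. Poly_Mapping.keys f \<subseteq> M}"
proof -
  have "Poly_Mapping.keys (c * f) \<subseteq> M" if "Poly_Mapping.keys f \<subseteq> M" for c f :: "('v, 'k) polyn"
  proof
    fix w assume "w \<in> Poly_Mapping.keys (c * f)"
    then obtain u v where "u \<in> Poly_Mapping.keys c" "v \<in> Poly_Mapping.keys f" "w = u + v"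
      by (rule keys_multE)
    then show "w \<in> M" using that assms by (auto simp: monomial_upset_def)
  qed
  moreover have "Poly_Mapping.keys (f + g) \<subseteq> M"
    if "Poly_Mapping.keys f \<subseteq> M" "Poly_Mapping.keys g \<subseteq> M" for f g :: "('v, 'k) polyn"
    using keys_add[of f g] that by (meson Un_least order_trans)
  ultimately show ?thesis
    unfolding ring_ideal.subspace_def by simp
qed

lemma ideal_generated_monomials:
  assumes "monomial_upset M"
  shows "ideal_generated {Poly_Mapping.single m (1 :: 'k::comm_ring_1) | m. m \<in> M}
    = {f :: ('v, 'k) polyn. Poly_Mapping.keys f \<subseteq> M}" (is "ideal_generated ?G = ?J")
proof
  show "ideal_generated ?G \<subseteq> ?J"
    by (rule ring_ideal.span_minimal[OF _ is_ideal_keys_subset[OF assms]]) auto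
  show "?J \<subseteq> ideal_generated ?G"
  proof
    fix f assume f: "f \<in> ?J"
    have "f = (\<Sum>m\<in>Poly_Mapping.keys f. Poly_Mapping.single 0 (Poly_Mapping.lookup f m) * Poly_Mapping.single m 1)"
      by (rule poly_mapping_eqI)
        (simp add: mult_single lookup_sum lookup_single when_def in_keys_iff)
    also have "\<dots> \<in> ideal_generated ?G"
      using f by (intro ring_ideal.span_sum ring_ideal.span_scale ring_ideal.span_base) auto
    finally show "f \<in> ideal_generated ?G" .
  qed
qed

text \<open>
  If \<open>f ^ k\<close> lies in the ideal, so does \<open>g ^ k\<close>, where \<open>g\<close> collects the terms of \<open>f\<close> outside the
  ideal.  If \<open>g\<close> is not \<open>0\<close>, with initial monomial \<open>m\<close>, then the initial monomial of \<open>g ^ k\<close> is the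
  \<open>k\<close>-th power of \<open>m\<close>, so this power lies in the ideal.  A squarefree divisor of it already
  divides \<open>m\<close>, which contradicts the choice of \<open>g\<close>.  Any monomial order serves for this argument.
\<close>

lemma is_radical_ideal_monomials:
  fixes M :: "('v::finite \<Rightarrow>\<^sub>0 nat) set"
  assumes up: "monomial_upset M"
    and sqf: "\<And>m. m \<in> M \<Longrightarrow> \<exists>q\<in>M. \<forall>i. Poly_Mapping.lookup q i \<le> (if Poly_Mapping.lookup m i = 0 then 0 else 1)"
  shows "is_radical_ideal (ideal_generated {Poly_Mapping.single m (1 :: 'k::field) | m. m \<in> M})"
proof -
  define J where "J = {f :: ('v, 'k) polyn. Poly_Mapping.keys f \<subseteq> M}"
  have ideal: "is_ideal J" unfolding J_def by (rule is_ideal_keys_subset[OF up])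
  obtain r :: "'v rel" where r: "strict_linear_order_on UNIV r"
  proof -
    obtain h :: "'v \<Rightarrow> nat" where "inj h"
      using finite_imp_inj_to_nat_seg[of "UNIV :: 'v set"] by auto
    then have "strict_linear_order_on UNIV {(j, i). h j < h i}"
      by (rule strict_linear_order_on_measure)
    then show ?thesis using that by blast
  qed
  have "f \<in> J" if fk: "f ^ k \<in> J" and "k \<ge> 1" for f k
  proof (rule ccontr)
    assume "f \<notin> J"
    define g where "g = (\<Sum>m\<in>Poly_Mapping.keys f - M. Poly_Mapping.single m (Poly_Mapping.lookup f m))"
    have lookup_g: "Poly_Mapping.lookup g m = (if m \<in> M then 0 else Poly_Mapping.lookup f m)" for m
      by (auto simp: g_def lookup_sum lookup_single when_def in_keys_iff)
    have "f - g \<in> J"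
      by (auto simp: J_def in_keys_iff lookup_minus lookup_g split: if_splits)
    have "f ^ n - g ^ n \<in> J" for n
    proof (induction n)
      case 0
      show ?case using ring_ideal.subspace_0[OF ideal] by simp
    next
      case (Suc n)
      have "f ^ Suc n - g ^ Suc n = f * (f ^ n - g ^ n) + g ^ n * (f - g)"
        by (simp add: algebra_simps)
      then show ?case
        using Suc \<open>f - g \<in> J\<close> ring_ideal.subspace_add[OF ideal] ring_ideal.subspace_scale[OF ideal]
        by metis
    qed
    from ring_ideal.subspace_diff[OF ideal fk this[of k]] have gk: "g ^ k \<in> J" by simp
    obtain m0 where "m0 \<in> Poly_Mapping.keys f" "m0 \<notin> M" using \<open>f \<notin> J\<close> by (auto simp: J_def)
    then have "g \<noteq> 0" using lookup_g[of m0] by (auto simp: in_keys_iff)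
    then obtain m where m: "is_initial_monom (grevlex_less r) g m" using ex_initial_monom[OF r] by blast
    then obtain w where w: "is_initial_monom (grevlex_less r) (g ^ k) w" "\<And>i. Poly_Mapping.lookup w i = k * Poly_Mapping.lookup m i"
      using is_initial_monom_power[OF r] by blast
    have "w \<in> M" using w(1) gk by (auto simp: is_initial_monom_def J_def)
    then obtain q where q: "q \<in> M" "\<And>i. Poly_Mapping.lookup q i \<le> (if Poly_Mapping.lookup w i = 0 then 0 else 1)"
      using sqf by blast
    have "Poly_Mapping.lookup q i \<le> Poly_Mapping.lookup m i" for i
      using q(2)[of i] by (cases "Poly_Mapping.lookup m i") (auto simp: w(2) split: if_splits)
    then have "m = (m - q) + q"
      by (intro poly_mapping_eqI) (simp add: lookup_add lookup_minus)
    then have "m \<in> M" using q(1) up unfolding monomial_upset_def by metis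
    then show False using m lookup_g[of m] by (simp add: is_initial_monom_def in_keys_iff)
  qed
  then show ?thesis
    unfolding is_radical_ideal_def ideal_generated_monomials[OF up] J_def[symmetric]
    using ideal by blast
qed

section \<open>Multidegrees and toric ideals\<close>

definition multidegree :: "int ^ 'v ^ 'e \<Rightarrow> ('v::finite \<Rightarrow>\<^sub>0 nat) \<Rightarrow> int ^ 'e" where
  "multidegree C m = C *v (\<chi> i. int (Poly_Mapping.lookup m i))"

lemma multidegree_add: "multidegree C (u + v) = multidegree C u + multidegree C v"
proof -
  have "(\<chi> i. int (Poly_Mapping.lookup (u + v) i))
      = (\<chi> i. int (Poly_Mapping.lookup u i)) + (\<chi> i. int (Poly_Mapping.lookup v i))"
    by (simp add: vec_eq_iff lookup_add)
  then show ?thesis by (simp add: multidegree_def matrix_vector_right_distrib)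
qed

lemma laurent_monom_0: "laurent_monom 0 = 1"
  by (simp add: laurent_monom_def)

lemma laurent_monom_add: "laurent_monom (a + b) = laurent_monom a * laurent_monom b"
  by (simp add: laurent_monom_def mult_single)

lemma laurent_monom_power: "laurent_monom c ^ k = laurent_monom (int k *s c)"
proof (induction k)
  case 0
  show ?case by (simp add: laurent_monom_0)
next
  case (Suc k)
  have "int (Suc k) *s c = c + int k *s c"
    by (simp add: vec_eq_iff algebra_simps)
  then show ?case
    using Suc by (simp add: laurent_monom_add)
qed

lemma prod_laurent_monom:
  "finite I \<Longrightarrow> (\<Prod>i\<in>I. laurent_monom (c i)) = laurent_monom (\<Sum>i\<in>I. c i)"
  by (induction I rule: finite_induct) (simp_all add: laurent_monom_0 laurent_monom_add)

lemma toric_hom_eq_sum_multidegree: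
  fixes C :: "int ^ 'v ^ 'e" and p :: "('v::finite, 'k::comm_ring_1) polyn"
  shows "toric_hom C p =
    (\<Sum>m\<in>Poly_Mapping.keys p. Poly_Mapping.single (multidegree C m) (Poly_Mapping.lookup p m))"
proof -
  have "(\<Prod>i\<in>UNIV. laurent_monom (column i C) ^ Poly_Mapping.lookup m i)
      = (Poly_Mapping.single (multidegree C m) 1 :: ('e, 'k) laurent)" for m
    by (simp add: laurent_monom_power prod_laurent_monom multidegree_def matrix_mult_sum
        flip: laurent_monom_def)
  then show ?thesis
    by (simp add: toric_hom_def mult_single)
qed

lemma toric_ideal_iff:
  "p \<in> toric_ideal C \<longleftrightarrow>
    (\<forall>c. (\<Sum>m\<in>{m \<in> Poly_Mapping.keys p. multidegree C m = c}. Poly_Mapping.lookup p m) = 0)"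
proof -
  have "Poly_Mapping.lookup (toric_hom C p) c
      = (\<Sum>m\<in>{m \<in> Poly_Mapping.keys p. multidegree C m = c}. Poly_Mapping.lookup p m)" for c
    by (simp add: toric_hom_eq_sum_multidegree lookup_sum lookup_single when_def sum.If_cases
      Int_def)
  moreover have "toric_hom C p = 0 \<longleftrightarrow> (\<forall>c. Poly_Mapping.lookup (toric_hom C p) c = 0)"
    by (metis lookup_zero poly_mapping_eqI)
  ultimately show ?thesis by (simp add: toric_ideal_def)
qed

section \<open>Initial ideals of toric ideals\<close>

definition nonminimal_monoms ::
    "int ^ 'v ^ 'e \<Rightarrow> 'v rel \<Rightarrow> ('v::finite \<Rightarrow>\<^sub>0 nat) set" where
  "nonminimal_monoms C r = {m. \<exists>m'. multidegree C m' = multidegree C m \<and> grevlex_less r m' m}"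

lemma monomial_upset_nonminimal_monoms: "monomial_upset (nonminimal_monoms C r)"
  unfolding monomial_upset_def
proof (intro ballI allI)
  fix m a assume "m \<in> nonminimal_monoms C r"
  then obtain m' where "multidegree C m' = multidegree C m" "grevlex_less r m' m"
    by (auto simp: nonminimal_monoms_def)
  then have "multidegree C (a + m') = multidegree C (a + m)" "grevlex_less r (a + m') (a + m)"
    by (simp_all add: multidegree_add grevlex_less_add_left)
  then show "a + m \<in> nonminimal_monoms C r"
    by (auto simp: nonminimal_monoms_def)
qed

text \<open>
  The coefficients of an element of the toric ideal sum to zero within each multidegree, so its
  initial monomial shares its multidegree with another, smaller monomial.  Conversely, the
  difference of two monomials of equal multidegree is in the toric ideal.
\<close>

lemma initial_monoms_toric_ideal:
  "(\<exists>f\<in>(toric_ideal C :: ('v::finite, 'k::comm_ring_1) polyn set).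
      is_initial_monom (grevlex_less r) f m) \<longleftrightarrow> m \<in> nonminimal_monoms C r"
proof
  assume "\<exists>f\<in>(toric_ideal C :: ('v, 'k) polyn set). is_initial_monom (grevlex_less r) f m"
  then obtain f :: "('v, 'k) polyn"
    where f: "f \<in> toric_ideal C" "is_initial_monom (grevlex_less r) f m" by blast
  let ?F = "{u \<in> Poly_Mapping.keys f. multidegree C u = multidegree C m}"
  have m: "m \<in> Poly_Mapping.keys f" using f(2) by (simp add: is_initial_monom_def)
  have "?F \<noteq> {m}"
  proof
    assume "?F = {m}"
    then have "Poly_Mapping.lookup f m = 0"
      using f(1)[unfolded toric_ideal_iff, rule_format, of "multidegree C m"] by simp
    then show False using m by (simp add: in_keys_iff)
  qed
  then obtain m' where "m' \<in> ?F" "m' \<noteq> m" using m by blast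
  then show "m \<in> nonminimal_monoms C r"
    using f(2) by (auto simp: nonminimal_monoms_def is_initial_monom_def)
next
  assume "m \<in> nonminimal_monoms C r"
  then obtain m' where m': "multidegree C m' = multidegree C m" "grevlex_less r m' m"
    by (auto simp: nonminimal_monoms_def)
  then have ne: "m' \<noteq> m" using grevlex_less_irrefl by blast
  define f :: "('v, 'k) polyn" where "f = Poly_Mapping.single m 1 - Poly_Mapping.single m' 1"
  have lookup_f: "Poly_Mapping.lookup f u = (if u = m then 1 else if u = m' then -1 else 0)" for u
    using ne by (auto simp: f_def lookup_minus lookup_single when_def)
  then have keys_f: "Poly_Mapping.keys f = {m, m'}"
    by (auto simp: in_keys_iff split: if_splits)
  have "{u \<in> {m, m'}. multidegree C u = c} = (if c = multidegree C m then {m, m'} else {})" for c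
    using m'(1) by auto
  then have "f \<in> toric_ideal C"
    using ne by (auto simp: toric_ideal_iff keys_f lookup_f)
  moreover have "is_initial_monom (grevlex_less r) f m"
    using m'(2) by (simp add: is_initial_monom_def keys_f)
  ultimately show "\<exists>f\<in>(toric_ideal C :: ('v, 'k) polyn set). is_initial_monom (grevlex_less r) f m"
    by blast
qed

lemma initial_ideal_toric_ideal:
  "initial_ideal (grevlex_less r) (toric_ideal C :: ('v::finite, 'k::comm_ring_1) polyn set)
    = ideal_generated {Poly_Mapping.single m 1 | m. m \<in> nonminimal_monoms C r}"
  by (simp add: initial_ideal_def initial_monoms_toric_ideal)

section \<open>Centrally symmetric configurations\<close>

lemma sum_UNIV_option:
  "(\<Sum>c\<in>UNIV. f c) = f None + (\<Sum>s\<in>UNIV. f (Some s))" for f :: "'a::finite option \<Rightarrow> 'b::comm_monoid_add"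
  by (simp add: UNIV_option_conv sum.reindex)

lemma multidegree_centrally_symmetric_eq_iff:
  fixes A :: "int ^ 'n ^ 'd"
  shows "multidegree (centrally_symmetric A) u = multidegree (centrally_symmetric A) v \<longleftrightarrow>
    monom_degree u = monom_degree v \<and>
    signed_columns A *v (\<chi> s. int (Poly_Mapping.lookup u (Some s)) - int (Poly_Mapping.lookup v (Some s))) = 0"
proof -
  have None: "multidegree (centrally_symmetric A) m $ None = int (monom_degree m)" for m
    by (simp add: multidegree_def matrix_vector_mult_def centrally_symmetric_def monom_degree_def)
  have Some: "multidegree (centrally_symmetric A) m $ Some i
      = (\<Sum>s\<in>UNIV. signed_columns A $ i $ s * int (Poly_Mapping.lookup m (Some s)))" for m i
    by (simp add: multidegree_def matrix_vector_mult_def centrally_symmetric_def signed_columns_def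
        sum_UNIV_option)
  show ?thesis
    by (simp add: vec_eq_iff split_option_all None Some matrix_vector_mult_def right_diff_distrib sum_subtractf)
qed

text \<open>
  The order of variables is given by \<open>h\<close>, and \<open>h None = 0\<close> makes the variable of the zero column
  the smallest.  The divisor is the positive part of a kernel vector \<open>y\<close> that conforms to the
  exponent difference \<open>x\<close>; the functional that selects \<open>y\<close> depends on whether \<open>m\<close> and its smaller
  companion \<open>m'\<close> differ at the zero column.
\<close>

lemma nonminimal_monom_squarefree_divisor:
  fixes A :: "int ^ 'n ^ 'd" and h :: "('n + 'n) option \<Rightarrow> nat"
  assumes A: "unimodular A" and h: "inj h" "h None = 0"
    and m: "m \<in> nonminimal_monoms (centrally_symmetric A) {(j, i). h j < h i}"
  shows "\<exists>q\<in>nonminimal_monoms (centrally_symmetric A) {(j, i). h j < h i}.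
    \<forall>i. Poly_Mapping.lookup q i \<le> (if Poly_Mapping.lookup m i = 0 then 0 else 1)"
proof -
  let ?r = "{(j, i). h j < h i}" and ?S = "signed_columns A"
  obtain m' where m': "multidegree (centrally_symmetric A) m' = multidegree (centrally_symmetric A) m"
      "grevlex_less ?r m' m"
    using m by (auto simp: nonminimal_monoms_def)
  define x :: "int ^ ('n + 'n)" where
    "x = (\<chi> s. int (Poly_Mapping.lookup m (Some s)) - int (Poly_Mapping.lookup m' (Some s)))"
  have deg: "monom_degree m = monom_degree m'" and kerx: "?S *v x = 0"
    using m'(1)[symmetric] unfolding multidegree_centrally_symmetric_eq_iff x_def by auto
  obtain i0 where i0: "Poly_Mapping.lookup m' i0 > Poly_Mapping.lookup m i0"
    "\<And>j. h j < h i0 \<Longrightarrow> Poly_Mapping.lookup m' j = Poly_Mapping.lookup m j"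
    using m'(2) deg by (auto simp: grevlex_less_def)
  have sumx: "(\<Sum>s\<in>UNIV. x $ s)
      = int (Poly_Mapping.lookup m' None) - int (Poly_Mapping.lookup m None)"
    using arg_cong[OF deg, of int]
    by (simp add: monom_degree_def sum_UNIV_option x_def sum_subtractf)
  have h_pos: "h None < h (Some s)" for s
    using h by (metis injD neq0_conv option.distinct(1))
  \<comment> \<open>The two alternatives say that the passage from the positive to the negative part of \<open>y\<close>
    gains a power of the smallest variable, or gains the variable \<open>i0\<close> at equal degree.\<close>
  have "\<exists>y. ?S *v y = 0 \<and> sign_conforms y x \<and>
    ((\<Sum>s\<in>UNIV. y $ s) > 0 \<or> (\<Sum>s\<in>UNIV. y $ s) = 0 \<and> (\<exists>s. i0 = Some s \<and> y $ s = -1))"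
  proof (cases i0)
    case None
    then have "(\<Sum>s\<in>UNIV. (\<chi> s. 1) $ s * x $ s) > 0"
      using i0(1) sumx by simp
    from unimodular_kernel_conforming_positive[OF unimodular_signed_columns[OF A] kerx this]
    show ?thesis by auto
  next
    case (Some s0)
    have "(\<Sum>s\<in>UNIV. x $ s) = 0"
      using i0(2)[of None] h_pos sumx Some by simp
    \<comment> \<open>The functional \<open>2 * sum - v $ s0\<close> orders by the sum first, since \<open>y $ s0\<close> is at least \<open>-1\<close>.\<close>
    have func: "(\<Sum>s\<in>UNIV. (\<chi> s. if s = s0 then 1 else 2) $ s * v $ s) = 2 * (\<Sum>s\<in>UNIV. v $ s) - v $ s0"
      for v :: "int ^ ('n + 'n)"
    proof -
      have "(\<Sum>s\<in>UNIV. (\<chi> s. if s = s0 then 1 else 2) $ s * v $ s)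
          = (\<Sum>s\<in>UNIV. 2 * v $ s - (if s = s0 then v $ s else 0))"
        by (intro sum.cong) auto
      then show ?thesis by (simp add: sum_subtractf sum_distrib_left)
    qed
    have "(\<Sum>s\<in>UNIV. (\<chi> s. if s = s0 then 1 else 2) $ s * x $ s) > 0"
      unfolding func using \<open>(\<Sum>s\<in>UNIV. x $ s) = 0\<close> i0(1) Some by (simp add: x_def)
    from unimodular_kernel_conforming_positive[OF unimodular_signed_columns[OF A] kerx this]
    obtain y where y: "?S *v y = 0" "sign_conforms y x" "2 * (\<Sum>s\<in>UNIV. y $ s) - y $ s0 > 0"
      unfolding func by blast
    moreover have "y $ s0 \<in> {-1, 0, 1}" using y(2) by (auto simp: sign_conforms_def)
    ultimately show ?thesis using Some by (intro exI[of _ y]) auto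
  qed
  then obtain y where y: "?S *v y = 0" "sign_conforms y x"
    and pos: "(\<Sum>s\<in>UNIV. y $ s) > 0 \<or> (\<Sum>s\<in>UNIV. y $ s) = 0 \<and> (\<exists>s. i0 = Some s \<and> y $ s = -1)"
    by blast
  have y_val: "y $ s \<in> {-1, 0, 1}" for s
    using y(2) by (auto simp: sign_conforms_def)
  let ?d = "nat (\<Sum>s\<in>UNIV. y $ s)"
  define q where "q = Poly_Mapping.Abs_poly_mapping (\<lambda>c. case c of None \<Rightarrow> 0
    | Some s \<Rightarrow> nat (y $ s))"
  \<comment> \<open>The exponent \<open>?d\<close> of the zero column makes up for the difference in degree.\<close>
  define q' where "q' = Poly_Mapping.Abs_poly_mapping (\<lambda>c. case c of None \<Rightarrow> ?d
    | Some s \<Rightarrow> nat (- (y $ s)))"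
  have q: "Poly_Mapping.lookup q None = 0" "\<And>s. Poly_Mapping.lookup q (Some s) = nat (y $ s)"
    by (simp_all add: q_def)
  have q': "Poly_Mapping.lookup q' None = ?d" "\<And>s. Poly_Mapping.lookup q' (Some s) = nat (- (y $ s))"
    by (simp_all add: q'_def)
  have diff: "int (Poly_Mapping.lookup q (Some s)) - int (Poly_Mapping.lookup q' (Some s)) = y $ s" for s
    by (simp add: q q')
  have "int (monom_degree q) - int (monom_degree q') = (\<Sum>s\<in>UNIV. y $ s) - int ?d"
    by (simp add: monom_degree_def sum_UNIV_option q(1) q'(1) sum_subtractf flip: diff)
  then have degq: "monom_degree q = monom_degree q'" using pos by auto
  have "multidegree (centrally_symmetric A) q = multidegree (centrally_symmetric A) q'"
    unfolding multidegree_centrally_symmetric_eq_iff diff using degq y(1) by (simp add: vec_eq_iff)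
  moreover have "grevlex_less ?r q' q"
  proof -
    have "\<exists>i. Poly_Mapping.lookup q' i > Poly_Mapping.lookup q i \<and>
      (\<forall>j. h j < h i \<longrightarrow> Poly_Mapping.lookup q' j = Poly_Mapping.lookup q j)"
    proof (cases "(\<Sum>s\<in>UNIV. y $ s) > 0")
      case True
      then show ?thesis using h(2) q(1) q'(1) by (intro exI[of _ None]) simp
    next
      case False
      then obtain s0 where s0: "i0 = Some s0" "y $ s0 = -1" and "(\<Sum>s\<in>UNIV. y $ s) = 0"
        using pos by auto
      have "Poly_Mapping.lookup q' j = Poly_Mapping.lookup q j" if "h j < h i0" for j
      proof (cases j)
        case None
        then show ?thesis using q q' \<open>(\<Sum>s\<in>UNIV. y $ s) = 0\<close> by simp
      next
        case (Some s)
        \<comment> \<open>Below \<open>i0\<close> the vector \<open>x\<close> vanishes, and \<open>y\<close> with it.\<close>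
        then have "x $ s = 0" using i0(2)[OF that] by (simp add: x_def)
        then have "y $ s = 0" using y(2) unfolding sign_conforms_def by (metis less_irrefl)
        then show ?thesis using q q' Some by simp
      qed
      then show ?thesis using s0 q q' by (intro exI[of _ i0]) simp
    qed
    then show ?thesis using degq by (simp add: grevlex_less_def)
  qed
  ultimately have "q \<in> nonminimal_monoms (centrally_symmetric A) ?r"
    by (auto simp: nonminimal_monoms_def)
  moreover have "Poly_Mapping.lookup q i \<le> (if Poly_Mapping.lookup m i = 0 then 0 else 1)" for i
  proof (cases i)
    case None
    then show ?thesis by (simp add: q)
  next
    case (Some s)
    have "y $ s > 0 \<Longrightarrow> x $ s > 0" using y(2) unfolding sign_conforms_def by (smt (verit))
    then show ?thesis using Some y_val[of s] by (auto simp: q x_def)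
  qed
  ultimately show ?thesis by blast
qed

theorem theorem2p7:
  fixes A :: "int ^ 'n ^ 'd"
  assumes "unimodular A"
  shows "\<exists>lt. is_reverse_lex_order lt \<and>
           is_radical_ideal
             (initial_ideal lt
                (toric_ideal (centrally_symmetric A) :: (('n + 'n) option, 'k::field) polyn set))"
proof -
  obtain g :: "'n + 'n \<Rightarrow> nat" where "inj g"
    using finite_imp_inj_to_nat_seg[of "UNIV :: ('n + 'n) set"] by auto
  define h where "h c = (case c of None \<Rightarrow> 0 | Some s \<Rightarrow> Suc (g s))" for c
  have h: "inj h" "h None = 0"
  proof -
    show "inj h"
    proof (rule injI)
      fix a b assume "h a = h b"
      then show "a = b"
        using \<open>inj g\<close> by (cases a; cases b) (auto simp: h_def dest: injD)
    qed
  qed (simp add: h_def)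
  let ?r = "{(j, i). h j < h i}"
  have "is_reverse_lex_order (grevlex_less ?r)"
    unfolding is_reverse_lex_order_def
    by (intro exI[of _ ?r] conjI strict_linear_order_on_measure[OF h(1)] refl)
  moreover have "is_radical_ideal (initial_ideal (grevlex_less ?r)
      (toric_ideal (centrally_symmetric A) :: (('n + 'n) option, 'k) polyn set))"
    unfolding initial_ideal_toric_ideal
  proof (rule is_radical_ideal_monomials)
    show "monomial_upset (nonminimal_monoms (centrally_symmetric A) ?r)"
      by (rule monomial_upset_nonminimal_monoms)
  qed (rule nonminimal_monom_squarefree_divisor[OF assms h])
  ultimately show ?thesis by (intro exI conjI)
qed

end
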